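(* Fix shared class constants $\beta\ge 0$, $0<c_-\le c_+<\infty$, $\bar s_0>0$, $s_R\in(0,\bar s_0]$, and let $(F_S,K)\in\mathcal{M}_\star$ with A1 parameters $(\alpha,L)$, apparent endpoint $a=\ell(0+)$ and observed law $Q=KF_S$. Set $\underline{c}:=\liminf_{s\downarrow 0}c_K(s)$ and $\overline{c}:=\limsup_{s\downarrow 0}c_K(s)$. Then there exist constants $0<\varkappa_-\le\varkappa_+<\infty$, depending only on $\beta,c_-,c_+$ and on the member through $\alpha$ and $(\underline{c},\overline{c})$, such that for all sufficiently small $h>0$ (how small may depend on the member) $$\varkappa_-\,L\,h^{\alpha+\beta+2}\;\le\;Q([a,a+h])\;\le\;\varkappa_+\,L\,h^{\alpha+\beta+2}.$$ In particular $a=\inf\operatorname{supp}Q$ and $$\lim_{h\downarrow 0}\frac{\log Q([a,a+h])}{\log h}=\alpha+\beta+2,$$ so that the near-endpoint exponent is determined by $Q$ alone. If in addition $\ell(s)=a+c_\ell s$ on $[0,s_R]$ for some constant $c_\ell$ and $c_K(s)\to\bar c_K\in(0,\infty)$ as $s\downarrow 0$, then $$Q([a,a+h])=\bar c_K\,B(\alpha+1,\beta+2)\,L\,c_\ell^{-(\alpha+1)}\,h^{\alpha+\beta+2}(1+o(1))\qquad(h\downarrow 0),$$ where $B$ is the Euler Beta function.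
   Context: A pair $(F_S,K)$ consists of a Borel probability law $F_S$ on $[0,\infty)$ and a Markov kernel $K$ from $[0,\infty)$ to the compactified half-line $[0,\infty]$ such that $K([0,\infty)\mid s)>0$ for every $s\ge 0$ (well-posedness). Its observed law is the Borel probability $Q=KF_S$ on $[0,\infty]$, $Q(B)=\int_{[0,\infty)}K(B\mid s)\,F_S(ds)$. The lower conditional edge is $\ell(s):=\inf(\operatorname{supp}K(\cdot\mid s)\cap[0,\infty))$, with $\operatorname{supp}$ the topological support in $[0,\infty]$. Shared class constants: $\beta\ge 0$, $0<c_-\le c_+<\infty$, $\bar s_0>0$, $s_R\in(0,\bar s_0]$ (common to all members). Axioms: A1: $F_S(\{0\})=0$ and there are $s_0\ge\bar s_0$, $L\in(0,\infty)$, $\alpha\in[0,\infty)$ (member-specific) such that $F_S$ has a density $f_S$ on $(0,s_0)$ (a fixed version) with $f_S(s)=L s^{\alpha}(1+o(1))$ pointwise as $s\downarrow 0$. A5$^-$: the limit $a:=\ell(0+)\in[0,\infty)$ exists (the apparent endpoint); $c_-s\le\ell(s)-a\le c_+s$ for all $s\in(0,s_R]$; and $\ell$ is nondecreasing on $[0,\infty)$, where by notational convention $\ell(0):=a$ (no constraint on $K(\cdot\mid 0)$). A6: there is a map $c_K:(0,s_R]\to(0,\infty)$ with $0<\liminf_{s\downarrow 0}c_K(s)\le\limsup_{s\downarrow 0}c_K(s)<\infty$ such that for every $\varepsilon>0$ there is $\eta(\varepsilon)>0$ with $(1-\varepsilon)c_K(s)\delta^{\beta+1}\le K([\ell(s),\ell(s)+\delta]\mid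 s)\le(1+\varepsilon)c_K(s)\delta^{\beta+1}$ for all $s\in(0,s_R]$ and $\delta\in(0,\eta(\varepsilon)]$. The lean class $\mathcal{M}_\star$ is the set of all pairs $(F_S,K)$ satisfying well-posedness, A1, A5$^-$ and A6 with the given shared constants. *)

theory Defs
  imports "HOL-Probability.Probability"
begin

(* The compactified half-line [0,\<infinity>] is the type ennreal with its order topology.
   A law on [0,\<infinity>) is a measure on restrict_space borel {0..}; the values K s for s < 0
   are irrelevant. *)

definition markov_pair :: "real measure \<Rightarrow> (real \<Rightarrow> ennreal measure) \<Rightarrow> bool" where
  "markov_pair F K \<longleftrightarrow>
     prob_space F \<and> sets F = sets (restrict_space borel {0..}) \<and>
     K \<in> restrict_space borel {0..} \<rightarrow>\<^sub>M prob_algebra borel"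

definition well_posed :: "real measure \<Rightarrow> (real \<Rightarrow> ennreal measure) \<Rightarrow> bool" where
  "well_posed F K \<longleftrightarrow> markov_pair F K \<and> (\<forall>s\<ge>0. emeasure (K s) {..<\<infinity>} > 0)"

definition observed_law :: "real measure \<Rightarrow> (real \<Rightarrow> ennreal measure) \<Rightarrow> ennreal measure" where
  "observed_law F K = F \<bind> K"

lemma emeasure_observed_law:
  assumes "markov_pair F K" "B \<in> sets borel"
  shows "emeasure (observed_law F K) B = (\<integral>\<^sup>+s. emeasure (K s) B \<partial>F)"
proof -
  have F: "prob_space F" "sets F = sets (restrict_space borel {0..})"
    and K: "K \<in> restrict_space borel {0..} \<rightarrow>\<^sub>M prob_algebra borel"
    using assms(1) by (auto simp: markov_pair_def)
  have "K \<in> F \<rightarrow>\<^sub>M subprob_algebra borel"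
    using measurable_prob_algebraD[OF K] by (simp cong: measurable_cong_sets add: F(2))
  then show ?thesis
    unfolding observed_law_def
    using assms(2) prob_space.not_empty[OF F(1)] by (intro emeasure_bind)
qed

definition measure_support :: "'a::topological_space measure \<Rightarrow> 'a set" where
  "measure_support M = {x. \<forall>U. open U \<and> x \<in> U \<longrightarrow> emeasure M U > 0}"

(* The infimum is taken in the reals; under well-posedness the set is nonempty. *)
definition lower_edge :: "(real \<Rightarrow> ennreal measure) \<Rightarrow> real \<Rightarrow> real" where
  "lower_edge K s = Inf {x. 0 \<le> x \<and> ennreal x \<in> measure_support (K s)}"

definition apparent_endpoint :: "(real \<Rightarrow> ennreal measure) \<Rightarrow> real" where
  "apparent_endpoint K = Lim (at_right 0) (lower_edge K)"

(* The lower edge with the notational convention that its value at 0 is the apparent endpoint. *)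
definition edge :: "(real \<Rightarrow> ennreal measure) \<Rightarrow> real \<Rightarrow> real" where
  "edge K = (lower_edge K)(0 := apparent_endpoint K)"

definition class_constants :: "real \<Rightarrow> real \<Rightarrow> real \<Rightarrow> real \<Rightarrow> real \<Rightarrow> bool" where
  "class_constants \<beta> c\<^sub>m c\<^sub>p sbar s\<^sub>R \<longleftrightarrow>
     0 \<le> \<beta> \<and> 0 < c\<^sub>m \<and> c\<^sub>m \<le> c\<^sub>p \<and> 0 < sbar \<and> 0 < s\<^sub>R \<and> s\<^sub>R \<le> sbar"

definition A1 :: "real \<Rightarrow> real measure \<Rightarrow> real \<Rightarrow> real \<Rightarrow> bool" where
  "A1 sbar F \<alpha> L \<longleftrightarrow>
     emeasure F {0} = 0 \<and> 0 \<le> \<alpha> \<and> 0 < L \<and>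
     (\<exists>s\<^sub>0\<ge>sbar. \<exists>f. f \<in> borel_measurable (restrict_space borel {0<..<s\<^sub>0}) \<and>
        (\<forall>s\<in>{0<..<s\<^sub>0}. 0 \<le> f s) \<and>
        (\<forall>B\<in>sets borel. B \<subseteq> {0<..<s\<^sub>0} \<longrightarrow>
           emeasure F B = (\<integral>\<^sup>+s\<in>B. ennreal (f s) \<partial>lborel)) \<and>
        f \<sim>[at_right 0] (\<lambda>s. L * s powr \<alpha>))"

(* Axiom A5\<^sup>-. Its first conjunct says exactly that the limit of the lower edge at 0+ exists. *)
definition A5 :: "real \<Rightarrow> real \<Rightarrow> real \<Rightarrow> (real \<Rightarrow> ennreal measure) \<Rightarrow> bool" where
  "A5 c\<^sub>m c\<^sub>p s\<^sub>R K \<longleftrightarrow>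
     (lower_edge K \<longlongrightarrow> apparent_endpoint K) (at_right 0) \<and>
     (\<forall>s\<in>{0<..s\<^sub>R}. c\<^sub>m * s \<le> lower_edge K s - apparent_endpoint K \<and>
                    lower_edge K s - apparent_endpoint K \<le> c\<^sub>p * s) \<and>
     mono_on {0..} (edge K)"

definition A6 :: "real \<Rightarrow> real \<Rightarrow> (real \<Rightarrow> ennreal measure) \<Rightarrow> (real \<Rightarrow> real) \<Rightarrow> bool" where
  "A6 \<beta> s\<^sub>R K c\<^sub>K \<longleftrightarrow>
     (\<forall>s\<in>{0<..s\<^sub>R}. 0 < c\<^sub>K s) \<and>
     0 < Liminf (at_right 0) (\<lambda>s. ereal (c\<^sub>K s)) \<and>
     Liminf (at_right 0) (\<lambda>s. ereal (c\<^sub>K s)) \<le> Limsup (at_right 0) (\<lambda>s. ereal (c\<^sub>K s)) \<and>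
     Limsup (at_right 0) (\<lambda>s. ereal (c\<^sub>K s)) < \<infinity> \<and>
     (\<forall>\<epsilon>>0. \<exists>\<eta>>0. \<forall>s\<in>{0<..s\<^sub>R}. \<forall>\<delta>\<in>{0<..\<eta>}.
        (1 - \<epsilon>) * c\<^sub>K s * \<delta> powr (\<beta> + 1)
          \<le> measure (K s) {ennreal (lower_edge K s)..ennreal (lower_edge K s + \<delta>)} \<and>
        measure (K s) {ennreal (lower_edge K s)..ennreal (lower_edge K s + \<delta>)}
          \<le> (1 + \<epsilon>) * c\<^sub>K s * \<delta> powr (\<beta> + 1))"

(* The lean class M_star. The member determines \<alpha>, L and c\<^sub>K on {0<..s\<^sub>R}. *)
definition lean_class ::
  "real \<Rightarrow> real \<Rightarrow> real \<Rightarrow> real \<Rightarrow> real \<Rightarrow> (real measure \<times> (real \<Rightarrow> ennreal measure)) set" where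
  "lean_class \<beta> c\<^sub>m c\<^sub>p sbar s\<^sub>R =
     {(F, K). well_posed F K \<and> (\<exists>\<alpha> L. A1 sbar F \<alpha> L) \<and> A5 c\<^sub>m c\<^sub>p s\<^sub>R K \<and> (\<exists>c\<^sub>K. A6 \<beta> s\<^sub>R K c\<^sub>K)}"

end

theory Submission
  imports Defs
begin

text \<open>
  Write \<open>\<ell>\<close> for the lower edge. Near the endpoint, \<open>K s {a..a + h}\<close> is the mass within
  distance \<open>a + h - \<ell> s\<close> of the edge, so by A6 it is about
  \<open>c\<^sub>K s * max 0 (a + h - \<ell> s) powr (\<beta> + 1)\<close>. Monotonicity of the edge confines the
  integration over \<open>s\<close> to a vanishing neighbourhood of 0, where the density is about
  \<open>L * s powr \<alpha>\<close>. If \<open>C * s \<le> \<ell> s - a\<close> and \<open>c\<^sub>K s \<le> D\<close>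
  for small \<open>s\<close>, then up to a factor tending to 1 the observed mass is at most \<open>D * L\<close> times
  a Beta integral that scales as \<open>C powr (- (\<alpha> + 1)) * h powr (\<alpha> + \<beta> + 2)\<close>; the
  reversed hypotheses give the reversed bound.
  The choices \<open>C = c\<^sub>m\<close>, \<open>C = c\<^sub>p\<close> and \<open>C = c\<^sub>l\<close> yield all the claims.
\<close>

section \<open>Supports, Beta integrals and local densities\<close>

lemma eventually_at_right_less_bound: "0 < c \<Longrightarrow> \<forall>\<^sub>F s :: real in at_right 0. s < c"
  by (rule eventually_at_rightI[of 0 c]) auto

text \<open>Each point of \<open>U\<close> has an open null neighbourhood. By second countability,
  countably many of these have the same union as all of them, so that union is still null.\<close>

lemma emeasure_open_disjoint_support:
  fixes M :: "'a::second_countable_topology measure"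
  assumes "open U" "U \<inter> measure_support M = {}" "sets M = sets borel"
  shows "emeasure M U = 0"
proof -
  define \<F> where "\<F> = {V. open V \<and> emeasure M V = 0}"
  have op: "\<And>V. V \<in> \<F> \<Longrightarrow> open V" by (simp add: \<F>_def)
  obtain \<F>' where F': "\<F>' \<subseteq> \<F>" "countable \<F>'" "\<Union>\<F>' = \<Union>\<F>"
    using Lindelof[OF op] by blast
  have "(\<Union>V\<in>\<F>'. V) \<in> null_sets M"
    using F' by (intro null_sets_UN') (auto simp: \<F>_def null_sets_def assms(3))
  moreover have "U \<subseteq> \<Union>\<F>"
    using assms(2) unfolding measure_support_def \<F>_def zero_less_iff_neq_zero by blast
  ultimately show ?thesis
    using F'(3) emeasure_mono[of U "\<Union>\<F>'" M] by (auto simp: null_sets_def)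
qed

text \<open>The substitution \<open>s = h / C * t\<close> turns the integrand into the Beta
  integrand on the unit interval; the truncation by \<open>max 0\<close> supplies the upper limit
  \<open>t = 1\<close>.\<close>

lemma nn_integral_Beta_scaled:
  fixes a b C h :: real
  assumes "a > 0" "b > 0" "C > 0" "h > 0"
  shows "(\<integral>\<^sup>+s\<in>{0<..}. ennreal (s powr (a - 1) * max 0 (h - C * s) powr (b - 1)) \<partial>lborel)
    = ennreal (Beta a b * C powr (- a) * h powr (a + b - 1))"
proof -
  define \<phi> :: "real \<Rightarrow> real"
    where "\<phi> = (\<lambda>t. indicator {0..1} t * (t powr (a - 1) * (1 - t) powr (b - 1)))"
  have \<phi>: "(\<phi> has_integral Beta a b) UNIV"
  proof -
    have "\<phi> = (\<lambda>t. if t \<in> {0..1} then t powr (a - 1) * (1 - t) powr (b - 1) else 0)"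
      by (auto simp: \<phi>_def)
    then show ?thesis
      using has_integral_Beta_real[OF assms(1,2)] by (simp only: has_integral_restrict_UNIV)
  qed
  have \<phi>_borel: "\<phi> \<in> borel_measurable borel"
    unfolding \<phi>_def by measurable
  have \<phi>_int: "(\<integral>\<^sup>+t. ennreal (\<phi> t) \<partial>lborel) = ennreal (Beta a b)"
    by (rule nn_integral_has_integral_lborel[OF \<phi>_borel _ \<phi>]) (simp add: \<phi>_def)
  have Beta_nonneg: "0 \<le> Beta a b"
    using assms by (simp add: Beta_def Gamma_real_pos less_imp_le)
  define k where "k = (h / C) powr (a - 1) * h powr (b - 1)"
  have k: "k \<ge> 0" by (simp add: k_def)
  \<comment> \<open>Outside the open unit interval both sides vanish. At \<open>t = 0\<close> and
    \<open>t = 1\<close> this relies on the convention \<open>0 powr x = 0\<close>.\<close>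
  have scale: "ennreal ((h / C * t) powr (a - 1) * max 0 (h - C * (h / C * t)) powr (b - 1))
      * indicator {0<..} (h / C * t) = ennreal k * ennreal (\<phi> t)" for t
  proof (cases "0 < t \<and> t < 1")
    case True
    have "h - C * (h / C * t) = h * (1 - t)"
      using assms by (simp add: field_simps)
    then have "max 0 (h - C * (h / C * t)) powr (b - 1) = h powr (b - 1) * (1 - t) powr (b - 1)"
      using True assms by (simp add: powr_mult)
    moreover have "(h / C * t) powr (a - 1) = (h / C) powr (a - 1) * t powr (a - 1)"
      using True assms by (subst powr_mult) auto
    ultimately have "(h / C * t) powr (a - 1) * max 0 (h - C * (h / C * t)) powr (b - 1) = k * \<phi> t"
      using True by (simp add: k_def \<phi>_def)
    moreover have "h / C * t > 0"
      using True assms by simp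
    ultimately show ?thesis
      using k by (simp add: ennreal_mult')
  next
    case False
    then have "t \<le> 0 \<or> h * t \<ge> h"
      using assms by auto
    then show ?thesis
      using False assms by (auto simp: \<phi>_def indicator_def zero_less_mult_iff zero_less_divide_iff)
  qed
  have "(\<integral>\<^sup>+s\<in>{0<..}. ennreal (s powr (a - 1) * max 0 (h - C * s) powr (b - 1)) \<partial>lborel)
     = ennreal \<bar>h / C\<bar> * (\<integral>\<^sup>+t. ennreal k * ennreal (\<phi> t) \<partial>lborel)"
    using assms by (subst nn_integral_real_affine[where c = "h / C" and t = 0]) (simp_all only: scale add_0, auto)
  also have "\<dots> = ennreal (h / C) * (ennreal k * ennreal (Beta a b))"
    using assms \<phi>_borel by (subst nn_integral_cmult) (auto simp: \<phi>_int)
  also have "\<dots> = ennreal (h / C * k * Beta a b)"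
    using assms k Beta_nonneg by (simp add: ennreal_mult mult_ac del: times_divide_eq_left times_divide_eq_right)
  also have "h / C * k = (h / C) powr a * h powr (b - 1)"
    using assms powr_add[of "h / C" 1 "a - 1"] by (simp add: k_def)
  also have "\<dots> = C powr (- a) * h powr (a + b - 1)"
    using assms by (simp add: powr_divide powr_minus_divide powr_add powr_diff)
  finally show ?thesis
    by (simp add: mult_ac)
qed

text \<open>The density is known only inside \<open>I\<close>, so \<open>F\<close> itself is not a
  \<open>density\<close> measure. After restriction to \<open>J\<close> it agrees with one, and
  integrals over \<open>J\<close> see only the restrictions.\<close>

lemma nn_integral_eq_density_on:
  fixes F :: "real measure"
  assumes F: "sets F = sets (restrict_space borel {0..})"
    and I: "I \<in> sets borel" "I \<subseteq> {0..}"
    and f: "f \<in> borel_measurable (restrict_space borel I)"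
    and dens: "\<And>B. B \<in> sets borel \<Longrightarrow> B \<subseteq> I \<Longrightarrow> emeasure F B = (\<integral>\<^sup>+s\<in>B. ennreal (f s) \<partial>lborel)"
    and g: "g \<in> borel_measurable borel"
    and J: "J \<in> sets borel" "J \<subseteq> I"
  shows "(\<integral>\<^sup>+s\<in>J. g s \<partial>F) = (\<integral>\<^sup>+s\<in>J. ennreal (f s) * g s \<partial>lborel)"
proof -
  have spF: "space F = {0..}"
    using sets_eq_imp_space_eq[OF F] by (simp add: space_restrict_space)
  \<comment> \<open>Extension by zero makes the density measurable on the whole line.\<close>
  define f' where "f' = (\<lambda>s. ennreal (f s) * indicator I s)"
  have f': "f' \<in> borel_measurable lborel"
    using f I(1) measurable_compose[OF f measurable_ennreal]
    by (simp add: f'_def borel_measurable_restrict_space_iff_ennreal)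
  have setsF: "B \<in> sets F" if "B \<in> sets borel" "B \<subseteq> {0..}" for B
    using that by (auto simp: F sets_restrict_space_iff)
  have J0: "J \<subseteq> {0..}" using J(2) I(2) by simp
  have JF: "J \<inter> space F \<in> sets F"
    using setsF[OF J(1) J0] J0 by (simp add: spF Int_absorb2)
  have eq: "restrict_space F J = restrict_space (density lborel f') J"
  proof (rule measure_eqI)
    show "sets (restrict_space F J) = sets (restrict_space (density lborel f') J)"
      using J0 by (auto simp: sets_restrict_space F image_image)
    fix B assume B: "B \<in> sets (restrict_space F J)"
    then have B': "B \<subseteq> J" "B \<in> sets F"
      using JF by (auto simp: sets_restrict_space_iff)
    then have B'': "B \<in> sets borel"
      by (auto simp: F sets_restrict_space_iff)
    have "emeasure (restrict_space F J) B = emeasure F B"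
      using B' JF by (simp add: emeasure_restrict_space)
    also have "\<dots> = (\<integral>\<^sup>+s\<in>B. ennreal (f s) \<partial>lborel)"
      using B' B'' J by (intro dens) auto
    also have "\<dots> = (\<integral>\<^sup>+s\<in>B. f' s \<partial>lborel)"
      using B' J by (intro nn_integral_cong) (auto simp: f'_def indicator_def)
    also have "\<dots> = emeasure (density lborel f') B"
      using f' B'' by (subst emeasure_density) auto
    also have "\<dots> = emeasure (restrict_space (density lborel f') J) B"
      using B' J by (simp add: emeasure_restrict_space)
    finally show "emeasure (restrict_space F J) B = emeasure (restrict_space (density lborel f') J) B" .
  qed
  have "(\<integral>\<^sup>+s\<in>J. g s \<partial>F) = nn_integral (restrict_space F J) g"
    using JF by (simp add: nn_integral_restrict_space)
  also have "\<dots> = (\<integral>\<^sup>+s\<in>J. g s \<partial>density lborel f')"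
    unfolding eq using J by (simp add: nn_integral_restrict_space)
  also have "\<dots> = (\<integral>\<^sup>+s. f' s * (g s * indicator J s) \<partial>lborel)"
    using f' g J by (subst nn_integral_density) auto
  also have "\<dots> = (\<integral>\<^sup>+s\<in>J. ennreal (f s) * g s \<partial>lborel)"
    using J(2) by (intro nn_integral_cong) (auto simp: f'_def indicator_def)
  finally show ?thesis .
qed

section \<open>Setting of a fixed member of the class\<close>

text \<open>Membership hides \<open>\<alpha>\<close>, \<open>L\<close> and \<open>c\<^sub>K\<close>
  behind existential quantifiers. Fixing them by separate assumptions lets the bounds refer to
  chosen witnesses.\<close>

locale lean_member =
  fixes \<beta> c\<^sub>m c\<^sub>p sbar s\<^sub>R \<alpha> L :: real and F :: "real measure"
    and K :: "real \<Rightarrow> ennreal measure" and c\<^sub>K :: "real \<Rightarrow> real"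
  assumes constants: "class_constants \<beta> c\<^sub>m c\<^sub>p sbar s\<^sub>R"
    and member: "(F, K) \<in> lean_class \<beta> c\<^sub>m c\<^sub>p sbar s\<^sub>R"
    and A1: "A1 sbar F \<alpha> L"
    and A6: "A6 \<beta> s\<^sub>R K c\<^sub>K"
begin

abbreviation "a \<equiv> apparent_endpoint K"
abbreviation "Q \<equiv> observed_law F K"

lemma markov: "markov_pair F K"
  and well_posed: "well_posed F K"
  and A5: "A5 c\<^sub>m c\<^sub>p s\<^sub>R K"
  using member by (auto simp: lean_class_def well_posed_def)

lemma pos: "0 \<le> \<beta>" "0 < c\<^sub>m" "c\<^sub>m \<le> c\<^sub>p" "0 < c\<^sub>p" "0 < sbar" "0 < s\<^sub>R" "s\<^sub>R \<le> sbar" "0 \<le> \<alpha>" "0 < L"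
  using constants A1 by (auto simp: class_constants_def A1_def)

lemma cK_pos: "0 < s \<Longrightarrow> s \<le> s\<^sub>R \<Longrightarrow> 0 < c\<^sub>K s"
  using A6 by (auto simp: A6_def)

lemma prob_space_F: "prob_space F"
  and sets_F: "sets F = sets (restrict_space borel {0..})"
  and K_measurable: "K \<in> restrict_space borel {0..} \<rightarrow>\<^sub>M prob_algebra borel"
  using markov by (auto simp: markov_pair_def)

lemma space_F: "space F = {0..}"
  using sets_eq_imp_space_eq[OF sets_F] by (simp add: space_restrict_space)

lemma
  assumes "0 \<le> s"
  shows prob_space_K: "prob_space (K s)" and sets_K: "sets (K s) = sets borel"
proof -
  have "K s \<in> space (prob_algebra borel)"
    using measurable_space[OF K_measurable, of s] assms by (simp add: space_restrict_space)
  then show "prob_space (K s)" "sets (K s) = sets borel"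
    by (auto simp: space_prob_algebra)
qed

lemma emeasure_Q:
  "B \<in> sets borel \<Longrightarrow> emeasure Q B = (\<integral>\<^sup>+s. emeasure (K s) B \<partial>F)"
  by (rule emeasure_observed_law[OF markov])

lemma prob_space_Q: "prob_space Q" and sets_Q: "sets Q = sets borel"
proof -
  have KF: "K \<in> F \<rightarrow>\<^sub>M prob_algebra borel"
    using K_measurable by (simp cong: measurable_cong_sets add: sets_F)
  have F: "F \<in> space (prob_algebra F)"
    using prob_space_F by (simp add: space_prob_algebra)
  show "prob_space Q"
    unfolding observed_law_def by (rule prob_space_bind'[OF F KF])
  show "sets Q = sets borel"
    unfolding observed_law_def by (rule sets_bind'[OF F KF])
qed

lemma emeasure_K_measurable:
  "B \<in> sets borel \<Longrightarrow> (\<lambda>s. emeasure (K s) B) \<in> borel_measurable F"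
  using measurable_emeasure_kernel[OF measurable_prob_algebraD[OF K_measurable]]
  by (simp cong: measurable_cong_sets add: sets_F)

section \<open>Lower edge of the kernel\<close>

text \<open>The set under \<open>Inf\<close> consists of nonnegative reals, so the point is that it
  is nonempty. A support without finite points would make the open set
  \<open>{..<\<infinity>}\<close> null, against well-posedness.\<close>

lemma lower_edge_nonneg:
  assumes "0 \<le> s"
  shows "0 \<le> lower_edge K s"
proof -
  have "\<exists>y \<in> measure_support (K s). y < \<infinity>"
  proof (rule ccontr)
    assume "\<not> ?thesis"
    then have "emeasure (K s) {..<\<infinity>} = 0"
      by (intro emeasure_open_disjoint_support sets_K assms) auto
    then show False
      using well_posed assms unfolding well_posed_def by auto
  qed
  then obtain y where "y \<in> measure_support (K s)" "y < \<infinity>"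
    by auto
  then have "enn2real y \<in> {x. 0 \<le> x \<and> ennreal x \<in> measure_support (K s)}"
    by (simp add: less_top)
  then show ?thesis
    unfolding lower_edge_def by (intro cInf_greatest) blast+
qed

text \<open>A support point below the edge would be finite and hence belong to the set whose infimum
  is the edge. The open ray therefore misses the support.\<close>

lemma emeasure_K_below_edge:
  assumes "0 \<le> s"
  shows "emeasure (K s) {..<ennreal (lower_edge K s)} = 0"
proof (rule emeasure_open_disjoint_support)
  show "{..<ennreal (lower_edge K s)} \<inter> measure_support (K s) = {}"
  proof safe
    fix y assume y: "y < ennreal (lower_edge K s)" "y \<in> measure_support (K s)"
    have "y < top"
      using y(1) ennreal_less_top by (rule order.strict_trans)
    then have eq: "ennreal (enn2real y) = y"
      by simp
    have "lower_edge K s \<le> enn2real y"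
      unfolding lower_edge_def using y(2) eq by (intro cInf_lower bdd_belowI[of _ 0]) auto
    then show "y \<in> {}"
      using y(1) eq ennreal_leI leD by metis
  qed
qed (use assms sets_K in auto)

lemma emeasure_K_interval:
  assumes "0 \<le> s" "x \<le> lower_edge K s"
  shows "emeasure (K s) {ennreal x..ennreal y} = emeasure (K s) {ennreal (lower_edge K s)..ennreal y}"
proof -
  have "emeasure (K s) {ennreal x..ennreal y} \<le>
      emeasure (K s) ({..<ennreal (lower_edge K s)} \<union> {ennreal (lower_edge K s)..ennreal y})"
    using assms by (intro emeasure_mono) (auto simp: sets_K)
  also have "\<dots> \<le> emeasure (K s) {..<ennreal (lower_edge K s)} + emeasure (K s) {ennreal (lower_edge K s)..ennreal y}"
    using assms by (intro emeasure_subadditive) (auto simp: sets_K)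
  finally have "emeasure (K s) {ennreal x..ennreal y} \<le> emeasure (K s) {ennreal (lower_edge K s)..ennreal y}"
    using emeasure_K_below_edge assms by simp
  moreover have "emeasure (K s) {ennreal (lower_edge K s)..ennreal y} \<le> emeasure (K s) {ennreal x..ennreal y}"
    using assms by (intro emeasure_mono) (auto simp: sets_K intro: order_trans[OF ennreal_leI])
  ultimately show ?thesis
    by (rule antisym)
qed

lemma endpoint_tendsto: "(lower_edge K \<longlongrightarrow> a) (at_right 0)"
  and edge_bounds: "\<And>s. 0 < s \<Longrightarrow> s \<le> s\<^sub>R \<Longrightarrow> c\<^sub>m * s \<le> lower_edge K s - a \<and> lower_edge K s - a \<le> c\<^sub>p * s"
  using A5 by (auto simp: A5_def)

lemma lower_edge_mono:
  assumes "0 < s" "s \<le> t"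
  shows "lower_edge K s \<le> lower_edge K t"
proof -
  have "mono_on {0..} (edge K)" using A5 by (simp add: A5_def)
  then show ?thesis
    using mono_onD[of "{0..}" "edge K" s t] assms by (simp add: edge_def)
qed

text \<open>The convention \<open>edge K 0 = a\<close> turns monotonicity of \<open>edge K\<close>
  into this bound, which thus holds beyond \<open>s\<^sub>R\<close> as well.\<close>

lemma endpoint_le:
  assumes "0 < s"
  shows "a \<le> lower_edge K s"
proof -
  have "mono_on {0..} (edge K)" using A5 by (simp add: A5_def)
  then show ?thesis
    using mono_onD[of "{0..}" "edge K" 0 s] assms by (simp add: edge_def)
qed

lemma endpoint_nonneg: "0 \<le> a"
  by (rule tendsto_lowerbound[OF endpoint_tendsto])
     (auto intro!: lower_edge_nonneg eventually_at_rightI[of 0 1])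

section \<open>Signal density and kernel mass near the endpoint\<close>

lemma AE_pos: "AE s in F. 0 < s"
proof (rule AE_I')
  show "{0} \<in> null_sets F"
    using A1 by (auto simp: A1_def null_sets_def sets_F sets_restrict_space_iff)
qed (auto simp: space_F)

text \<open>A ratio tending to 1 eventually lies within \<open>\<epsilon>\<close> of 1, which yields
  the two-sided bounds. The same \<open>s\<^sub>0\<close> and \<open>f\<close> serve every
  \<open>\<epsilon>\<close>.\<close>

lemma density:
  obtains s\<^sub>0 f where "0 < s\<^sub>0"
    and "\<And>g J. g \<in> borel_measurable borel \<Longrightarrow> J \<in> sets borel \<Longrightarrow> J \<subseteq> {0<..<s\<^sub>0} \<Longrightarrow>
      (\<integral>\<^sup>+s\<in>J. g s \<partial>F) = (\<integral>\<^sup>+s\<in>J. ennreal (f s) * g s \<partial>lborel)"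
    and "\<And>\<epsilon>. 0 < \<epsilon> \<Longrightarrow> \<forall>\<^sub>F s in at_right 0.
      (1 - \<epsilon>) * (L * s powr \<alpha>) \<le> f s \<and> f s \<le> (1 + \<epsilon>) * (L * s powr \<alpha>)"
proof -
  obtain s\<^sub>0 f where s0: "s\<^sub>0 \<ge> sbar"
    and f: "f \<in> borel_measurable (restrict_space borel {0<..<s\<^sub>0})"
    and dens: "\<And>B. B \<in> sets borel \<Longrightarrow> B \<subseteq> {0<..<s\<^sub>0} \<Longrightarrow>
           emeasure F B = (\<integral>\<^sup>+s\<in>B. ennreal (f s) \<partial>lborel)"
    and asymp: "f \<sim>[at_right 0] (\<lambda>s. L * s powr \<alpha>)"
    using A1 by (auto simp: A1_def)
  have pos_rhs: "\<forall>\<^sub>F s in at_right 0. 0 < L * s powr \<alpha>"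
    using pos by (auto intro!: eventually_at_rightI[of 0 1])
  \<comment> \<open>Asymptotic equivalence reads a quotient of two zeros as 1; since
    \<open>L * s powr \<alpha>\<close> is eventually positive, the plain quotient has the same
    limit.\<close>
  have ratio: "((\<lambda>s. f s / (L * s powr \<alpha>)) \<longlongrightarrow> 1) (at_right 0)"
    by (rule asymp_equivD_strong[OF asymp]) (use pos_rhs in eventually_elim, auto)
  have bounds: "\<forall>\<^sub>F s in at_right 0. (1 - \<epsilon>) * (L * s powr \<alpha>) \<le> f s \<and> f s \<le> (1 + \<epsilon>) * (L * s powr \<alpha>)"
    if "0 < \<epsilon>" for \<epsilon> :: real
  proof -
    have "\<forall>\<^sub>F s in at_right 0. 1 - \<epsilon> < f s / (L * s powr \<alpha>)" "\<forall>\<^sub>F s in at_right 0. f s / (L * s powr \<alpha>) < 1 + \<epsilon>"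
      using order_tendstoD[OF ratio] that by auto
    then show ?thesis
      using pos_rhs by eventually_elim (auto simp: pos_less_divide_eq pos_divide_less_eq)
  qed
  show thesis
  proof (rule that)
    show "0 < s\<^sub>0" using s0 pos by linarith
    show "(\<integral>\<^sup>+s\<in>J. g s \<partial>F) = (\<integral>\<^sup>+s\<in>J. ennreal (f s) * g s \<partial>lborel)"
      if "g \<in> borel_measurable borel" "J \<in> sets borel" "J \<subseteq> {0<..<s\<^sub>0}" for g J
      by (rule nn_integral_eq_density_on[OF sets_F _ _ f dens]) (use that in auto)
  qed (rule bounds)
qed

text \<open>No mass lies below the edge, so the left end of the interval in A6 can be moved down to
  \<open>a\<close>. The truncation by \<open>max 0\<close> also covers edges at or above
  \<open>a + h\<close>, and \<open>\<eta>\<close> stays uniform in \<open>s\<close>.\<close>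

lemma K_interval_bounds:
  assumes "0 < \<epsilon>"
  obtains \<eta> where "0 < \<eta>"
    and "\<And>s h. 0 < s \<Longrightarrow> s \<le> s\<^sub>R \<Longrightarrow> 0 \<le> h \<Longrightarrow> h \<le> \<eta> \<Longrightarrow>
      (1 - \<epsilon>) * c\<^sub>K s * max 0 (a + h - lower_edge K s) powr (\<beta> + 1)
        \<le> measure (K s) {ennreal a..ennreal (a + h)} \<and>
      measure (K s) {ennreal a..ennreal (a + h)}
        \<le> (1 + \<epsilon>) * c\<^sub>K s * max 0 (a + h - lower_edge K s) powr (\<beta> + 1)"
proof -
  obtain \<eta> where \<eta>: "0 < \<eta>" and bound: "\<And>s \<delta>. s \<in> {0<..s\<^sub>R} \<Longrightarrow> \<delta> \<in> {0<..\<eta>} \<Longrightarrow>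
      (1 - \<epsilon>) * c\<^sub>K s * \<delta> powr (\<beta> + 1)
        \<le> measure (K s) {ennreal (lower_edge K s)..ennreal (lower_edge K s + \<delta>)} \<and>
      measure (K s) {ennreal (lower_edge K s)..ennreal (lower_edge K s + \<delta>)}
        \<le> (1 + \<epsilon>) * c\<^sub>K s * \<delta> powr (\<beta> + 1)"
    using A6 assms unfolding A6_def by meson
  show thesis
  proof (rule that[OF \<eta>])
    fix s h assume s: "0 < s" "s \<le> s\<^sub>R" and h: "0 \<le> h" "h \<le> \<eta>"
    let ?\<delta> = "a + h - lower_edge K s"
    have edge: "0 \<le> lower_edge K s" "a \<le> lower_edge K s"
      using s lower_edge_nonneg endpoint_le by auto
    have eq: "measure (K s) {ennreal a..ennreal (a + h)} =
        measure (K s) {ennreal (lower_edge K s)..ennreal (lower_edge K s + ?\<delta>)}"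
      using emeasure_K_interval[of s a "a + h"] s edge by (simp add: measure_def)
    interpret K: prob_space "K s"
      using s by (intro prob_space_K) auto
    consider "?\<delta> < 0" | "?\<delta> = 0" | "?\<delta> > 0" by linarith
    then show "(1 - \<epsilon>) * c\<^sub>K s * max 0 ?\<delta> powr (\<beta> + 1)
        \<le> measure (K s) {ennreal a..ennreal (a + h)} \<and>
      measure (K s) {ennreal a..ennreal (a + h)}
        \<le> (1 + \<epsilon>) * c\<^sub>K s * max 0 ?\<delta> powr (\<beta> + 1)"
    proof cases
      case 1
      then have "ennreal (a + h) < ennreal (lower_edge K s)"
        using edge endpoint_nonneg h by (intro ennreal_lessI) auto
      then show ?thesis
        using 1 by (simp add: eq)
    next
      case 2
      \<comment> \<open>A6 only speaks of \<open>\<delta> > 0\<close>. Letting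
        \<open>\<delta>\<close> tend to 0 in its upper bound shows that the kernel has no atom at
        the edge.\<close>
      have "((\<lambda>\<delta>. \<delta> powr (\<beta> + 1)) \<longlongrightarrow> 0) (at_right 0)"
        using pos by (intro tendsto_zero_powrI[where b = "\<beta> + 1"])
          (auto intro!: tendsto_eq_intros eventually_at_rightI[of 0 1])
      then have "((\<lambda>\<delta>. (1 + \<epsilon>) * c\<^sub>K s * \<delta> powr (\<beta> + 1)) \<longlongrightarrow> 0) (at_right 0)"
        by (rule tendsto_mult_right_zero)
      moreover have "measure (K s) {ennreal a..ennreal (a + h)} \<le> (1 + \<epsilon>) * c\<^sub>K s * \<delta> powr (\<beta> + 1)"
        if "\<delta> \<in> {0<..<\<eta>}" for \<delta>
      proof -
        have "measure (K s) {ennreal a..ennreal (a + h)} \<le>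
            measure (K s) {ennreal (lower_edge K s)..ennreal (lower_edge K s + \<delta>)}"
          unfolding eq 2 using that s
          by (intro K.finite_measure_mono) (auto simp: sets_K intro: order_trans[OF _ ennreal_leI])
        then show ?thesis
          using bound[of s \<delta>] s that by auto
      qed
      ultimately have "measure (K s) {ennreal a..ennreal (a + h)} \<le> 0"
        using \<eta> by (intro tendsto_lowerbound[where F = "at_right 0"])
          (auto intro!: eventually_at_rightI[of 0 \<eta>])
      then show ?thesis
        using 2 measure_nonneg[of "K s" "{ennreal a..ennreal (a + h)}"] by simp
    next
      case 3
      then show ?thesis
        using bound[of s ?\<delta>] s h edge unfolding eq by (simp add: max_def)
    qed
  qed
qed

text \<open>This serves values of \<open>s\<close> that need not lie below \<open>s\<^sub>R\<close>,
  where A6 gives no information.\<close>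

lemma K_interval_eq_0:
  assumes "0 < s" "0 \<le> h" "a + h < lower_edge K s"
  shows "emeasure (K s) {ennreal a..ennreal (a + h)} = 0"
proof -
  have "ennreal (a + h) < ennreal (lower_edge K s)"
    using assms lower_edge_nonneg[of s] endpoint_nonneg endpoint_le[of s]
    by (intro ennreal_lessI) auto
  then show ?thesis
    using assms endpoint_le[of s] by (subst emeasure_K_interval) auto
qed

section \<open>Asymptotic bounds for the observed mass\<close>

text \<open>The mass of the kernel profile for the edge \<open>a + C * s\<close>, normalised by \<open>L\<close>, \<open>c\<^sub>K\<close> and the power of \<open>h\<close>.\<close>
definition G :: "real \<Rightarrow> real" where
  "G C = Beta (\<alpha> + 1) (\<beta> + 2) * C powr (- (\<alpha> + 1))"

lemma nn_integral_cone:
  assumes "0 < C" "0 < h"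
  shows "(\<integral>\<^sup>+s\<in>{0<..}. ennreal (s powr \<alpha> * max 0 (h - C * s) powr (\<beta> + 1)) \<partial>lborel)
    = ennreal (G C * h powr (\<alpha> + \<beta> + 2))"
  using nn_integral_Beta_scaled[of "\<alpha> + 1" "\<beta> + 2" C h] assms pos
  by (simp add: G_def add_ac)

lemma G_pos: "0 < C \<Longrightarrow> 0 < G C"
  using pos by (simp add: G_def Beta_def Gamma_real_pos)

text \<open>For small \<open>s\<close> the kernel mass and the density are dominated by their model
  forms; for the remaining \<open>s\<close> the edge lies beyond \<open>a + h\<close>. Extending the
  dominating integral to the whole half-line only enlarges it.\<close>

lemma Q_upper:
  assumes C: "0 < C" "\<forall>\<^sub>F s in at_right 0. C * s \<le> lower_edge K s - a"
    and D: "0 < D" "\<forall>\<^sub>F s in at_right 0. c\<^sub>K s \<le> D"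
    and \<kappa>: "D * G C < \<kappa>"
  shows "\<forall>\<^sub>F h in at_right 0.
    measure Q {ennreal a..ennreal (a + h)} \<le> \<kappa> * L * h powr (\<alpha> + \<beta> + 2)"
proof -
  \<comment> \<open>One factor \<open>1 + \<epsilon>\<close> pays for A6, the other for the density;
    the strict gap below \<open>\<kappa>\<close> absorbs both.\<close>
  have "((\<lambda>\<epsilon>. (1 + \<epsilon>) * (1 + \<epsilon>) * (D * G C)) \<longlongrightarrow> D * G C) (at_right 0)"
    by (auto intro!: tendsto_eq_intros)
  then have "\<forall>\<^sub>F \<epsilon> in at_right 0. (1 + \<epsilon>) * (1 + \<epsilon>) * (D * G C) < \<kappa> \<and> 0 < \<epsilon>"
    using \<kappa> by (intro eventually_conj order_tendstoD(2) eventually_at_right_less)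
  then obtain \<epsilon> :: real where \<epsilon>: "0 < \<epsilon>" "(1 + \<epsilon>) * (1 + \<epsilon>) * (D * G C) < \<kappa>"
    using eventually_happens trivial_limit_at_right_real by blast
  obtain s\<^sub>0 f where s0: "0 < s\<^sub>0" and dens: "\<And>g J. g \<in> borel_measurable borel \<Longrightarrow> J \<in> sets borel \<Longrightarrow> J \<subseteq> {0<..<s\<^sub>0} \<Longrightarrow>
      (\<integral>\<^sup>+s\<in>J. g s \<partial>F) = (\<integral>\<^sup>+s\<in>J. ennreal (f s) * g s \<partial>lborel)"
    and f: "\<And>\<epsilon>. 0 < \<epsilon> \<Longrightarrow> \<forall>\<^sub>F s in at_right 0.
      (1 - \<epsilon>) * (L * s powr \<alpha>) \<le> f s \<and> f s \<le> (1 + \<epsilon>) * (L * s powr \<alpha>)"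
    using density by blast
  obtain \<eta> where \<eta>: "0 < \<eta>"
    and K_le: "\<And>s h. 0 < s \<Longrightarrow> s \<le> s\<^sub>R \<Longrightarrow> 0 \<le> h \<Longrightarrow> h \<le> \<eta> \<Longrightarrow>
      measure (K s) {ennreal a..ennreal (a + h)}
        \<le> (1 + \<epsilon>) * c\<^sub>K s * max 0 (a + h - lower_edge K s) powr (\<beta> + 1)"
    using K_interval_bounds[OF \<epsilon>(1)] by metis
  have "\<forall>\<^sub>F s in at_right 0. C * s \<le> lower_edge K s - a \<and> c\<^sub>K s \<le> D \<and>
      f s \<le> (1 + \<epsilon>) * (L * s powr \<alpha>) \<and> s < s\<^sub>0 \<and> s < s\<^sub>R"
    using C(2) D(2) f[OF \<epsilon>(1)] eventually_at_right_less_bound[OF s0] eventually_at_right_less_bound[OF pos(6)]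
    by eventually_elim auto
  then obtain r where r: "0 < r" and near: "\<And>s. 0 < s \<Longrightarrow> s < r \<Longrightarrow>
      C * s \<le> lower_edge K s - a \<and> c\<^sub>K s \<le> D \<and>
      f s \<le> (1 + \<epsilon>) * (L * s powr \<alpha>) \<and> s < s\<^sub>0 \<and> s < s\<^sub>R"
    by (auto simp: eventually_at_right_field)
  define J where "J = {0<..<r}"
  have J: "J \<in> sets borel" "J \<subseteq> {0<..<s\<^sub>0}"
    using near by (auto simp: J_def)
  have bound: "measure Q {ennreal a..ennreal (a + h)} \<le> \<kappa> * L * h powr (\<alpha> + \<beta> + 2)"
    if h: "0 < h" "h < min \<eta> (C * (r / 2))" for h
  proof -
    define g where "g = (\<lambda>s. ennreal ((1 + \<epsilon>) * D * max 0 (h - C * s) powr (\<beta> + 1)))"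
    have g: "g \<in> borel_measurable borel"
      unfolding g_def by measurable
    have K_le_g: "emeasure (K s) {ennreal a..ennreal (a + h)} \<le> g s * indicator J s" if s: "0 < s" for s
    proof (cases "s < r")
      case True
      interpret K: prob_space "K s"
        using s by (intro prob_space_K) auto
      have "measure (K s) {ennreal a..ennreal (a + h)}
          \<le> (1 + \<epsilon>) * c\<^sub>K s * max 0 (a + h - lower_edge K s) powr (\<beta> + 1)"
        using near[OF s True] s h by (intro K_le) auto
      also have "\<dots> \<le> (1 + \<epsilon>) * D * max 0 (h - C * s) powr (\<beta> + 1)"
        using near[OF s True] pos D \<epsilon> cK_pos[of s] s by (intro mult_mono powr_mono2) auto
      finally show ?thesis
        using True s by (simp add: g_def J_def K.emeasure_eq_measure ennreal_leI)
    next
      case False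
      \<comment> \<open>The linear bound is available only for \<open>s < r\<close>, so it is
        applied at \<open>r / 2\<close>. As \<open>h < C * (r / 2)\<close>, monotonicity puts the
        edge above \<open>a + h\<close> for all \<open>s \<ge> r\<close>.\<close>
      have "C * (r / 2) \<le> lower_edge K (r / 2) - a"
        using near[of "r / 2"] r by auto
      moreover have "lower_edge K (r / 2) \<le> lower_edge K s"
        using False r by (intro lower_edge_mono) auto
      ultimately show ?thesis
        using s h by (subst K_interval_eq_0) auto
    qed
    have fg: "ennreal (f s) * g s * indicator J s \<le> ennreal ((1 + \<epsilon>) * (1 + \<epsilon>) * D * L) *
        (ennreal (s powr \<alpha> * max 0 (h - C * s) powr (\<beta> + 1)) * indicator {0<..} s)" for s
    proof (cases "s \<in> J")
      case True
      then have s: "0 < s" "s < r" by (auto simp: J_def)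
      have "ennreal (f s) * g s \<le> ennreal ((1 + \<epsilon>) * (L * s powr \<alpha>)) * g s"
        using near[OF s] by (intro mult_right_mono ennreal_leI) auto
      also have "\<dots> = ennreal ((1 + \<epsilon>) * (1 + \<epsilon>) * D * L) *
        ennreal (s powr \<alpha> * max 0 (h - C * s) powr (\<beta> + 1))"
        unfolding g_def using \<epsilon> D pos by (simp add: ennreal_mult'[symmetric] mult_ac)
      finally show ?thesis
        using True s by simp
    qed simp
    have "emeasure Q {ennreal a..ennreal (a + h)} = (\<integral>\<^sup>+s. emeasure (K s) {ennreal a..ennreal (a + h)} \<partial>F)"
      by (rule emeasure_Q) simp
    also have "\<dots> \<le> (\<integral>\<^sup>+s\<in>J. g s \<partial>F)"
      using AE_pos K_le_g by (intro nn_integral_mono_AE) auto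
    also have "\<dots> = (\<integral>\<^sup>+s\<in>J. ennreal (f s) * g s \<partial>lborel)"
      by (rule dens[OF g J])
    also have "\<dots> \<le> (\<integral>\<^sup>+s. ennreal ((1 + \<epsilon>) * (1 + \<epsilon>) * D * L) *
        (ennreal (s powr \<alpha> * max 0 (h - C * s) powr (\<beta> + 1)) * indicator {0<..} s) \<partial>lborel)"
      by (intro nn_integral_mono fg)
    also have "\<dots> = ennreal ((1 + \<epsilon>) * (1 + \<epsilon>) * D * L) * ennreal (G C * h powr (\<alpha> + \<beta> + 2))"
      using C h by (subst nn_integral_cmult) (auto simp: nn_integral_cone)
    also have "\<dots> = ennreal ((1 + \<epsilon>) * (1 + \<epsilon>) * (D * G C) * L * h powr (\<alpha> + \<beta> + 2))"
      using \<epsilon> D pos by (simp add: ennreal_mult'[symmetric] mult_ac)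
    also have "\<dots> \<le> ennreal (\<kappa> * L * h powr (\<alpha> + \<beta> + 2))"
      using \<epsilon> pos by (intro ennreal_leI mult_right_mono) auto
    \<comment> \<open>Returning from \<open>ennreal\<close> to real inequalities requires a
      nonnegative right-hand side, which follows from \<open>0 < D * G C < \<kappa>\<close>.\<close>
    finally show ?thesis
      using \<kappa> D G_pos[OF C(1)] pos
      by (simp add: finite_measure.emeasure_eq_measure[OF prob_space.finite_measure[OF prob_space_Q]]
          mult_pos_pos order_less_imp_le order_less_trans[of 0 "D * G C" \<kappa>])
  qed
  show ?thesis
    using bound \<eta> C r by (intro eventually_at_rightI[of 0 "min \<eta> (C * (r / 2))"]) auto
qed

text \<open>Discarding all \<open>s\<close> outside \<open>J\<close> can only reduce the observed
  mass. The model integral loses nothing there, because its profile vanishes once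
  \<open>C * s \<ge> h\<close>.\<close>

lemma Q_lower:
  assumes C: "0 < C" "\<forall>\<^sub>F s in at_right 0. lower_edge K s - a \<le> C * s"
    and D: "0 < D" "\<forall>\<^sub>F s in at_right 0. D \<le> c\<^sub>K s"
    and \<kappa>: "\<kappa> < D * G C"
  shows "\<forall>\<^sub>F h in at_right 0.
    \<kappa> * L * h powr (\<alpha> + \<beta> + 2) \<le> measure Q {ennreal a..ennreal (a + h)}"
proof -
  have "((\<lambda>\<epsilon>. (1 - \<epsilon>) * (1 - \<epsilon>) * (D * G C)) \<longlongrightarrow> D * G C) (at_right 0)"
    by (auto intro!: tendsto_eq_intros)
  \<comment> \<open>The condition \<open>\<epsilon> < 1\<close> keeps the factors
    \<open>1 - \<epsilon>\<close> positive, as products in \<open>ennreal\<close> demand.\<close>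
  then have "\<forall>\<^sub>F \<epsilon> in at_right 0. \<kappa> < (1 - \<epsilon>) * (1 - \<epsilon>) * (D * G C) \<and> 0 < \<epsilon> \<and> \<epsilon> < 1"
    using \<kappa> by (intro eventually_conj order_tendstoD(1) eventually_at_right_less)
      (auto intro!: eventually_at_rightI[of 0 1])
  then obtain \<epsilon> :: real where \<epsilon>: "0 < \<epsilon>" "\<epsilon> < 1" "\<kappa> < (1 - \<epsilon>) * (1 - \<epsilon>) * (D * G C)"
    using eventually_happens trivial_limit_at_right_real by blast
  obtain s\<^sub>0 f where s0: "0 < s\<^sub>0" and dens: "\<And>g J. g \<in> borel_measurable borel \<Longrightarrow> J \<in> sets borel \<Longrightarrow> J \<subseteq> {0<..<s\<^sub>0} \<Longrightarrow>
      (\<integral>\<^sup>+s\<in>J. g s \<partial>F) = (\<integral>\<^sup>+s\<in>J. ennreal (f s) * g s \<partial>lborel)"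
    and f: "\<And>\<epsilon>. 0 < \<epsilon> \<Longrightarrow> \<forall>\<^sub>F s in at_right 0.
      (1 - \<epsilon>) * (L * s powr \<alpha>) \<le> f s \<and> f s \<le> (1 + \<epsilon>) * (L * s powr \<alpha>)"
    using density by blast
  obtain \<eta> where \<eta>: "0 < \<eta>"
    and K_ge: "\<And>s h. 0 < s \<Longrightarrow> s \<le> s\<^sub>R \<Longrightarrow> 0 \<le> h \<Longrightarrow> h \<le> \<eta> \<Longrightarrow>
      (1 - \<epsilon>) * c\<^sub>K s * max 0 (a + h - lower_edge K s) powr (\<beta> + 1)
        \<le> measure (K s) {ennreal a..ennreal (a + h)}"
    using K_interval_bounds[OF \<epsilon>(1)] by metis
  have "\<forall>\<^sub>F s in at_right 0. lower_edge K s - a \<le> C * s \<and> D \<le> c\<^sub>K s \<and>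
      (1 - \<epsilon>) * (L * s powr \<alpha>) \<le> f s \<and> s < s\<^sub>0 \<and> s < s\<^sub>R"
    using C(2) D(2) f[OF \<epsilon>(1)] eventually_at_right_less_bound[OF s0] eventually_at_right_less_bound[OF pos(6)]
    by eventually_elim auto
  then obtain r where r: "0 < r" and near: "\<And>s. 0 < s \<Longrightarrow> s < r \<Longrightarrow>
      lower_edge K s - a \<le> C * s \<and> D \<le> c\<^sub>K s \<and>
      (1 - \<epsilon>) * (L * s powr \<alpha>) \<le> f s \<and> s < s\<^sub>0 \<and> s < s\<^sub>R"
    by (auto simp: eventually_at_right_field)
  define J where "J = {0<..<r}"
  have J: "J \<in> sets borel" "J \<subseteq> {0<..<s\<^sub>0}"
    using near by (auto simp: J_def)
  have bound: "\<kappa> * L * h powr (\<alpha> + \<beta> + 2) \<le> measure Q {ennreal a..ennreal (a + h)}"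
    if h: "0 < h" "h < min \<eta> (C * r)" for h
  proof -
    define g where "g = (\<lambda>s. ennreal ((1 - \<epsilon>) * D * max 0 (h - C * s) powr (\<beta> + 1)))"
    have g: "g \<in> borel_measurable borel"
      unfolding g_def by measurable
    have K_ge_g: "g s * indicator J s \<le> emeasure (K s) {ennreal a..ennreal (a + h)}" for s
    proof (cases "s \<in> J")
      case True
      then have s: "0 < s" "s < r" by (auto simp: J_def)
      interpret K: prob_space "K s"
        using s by (intro prob_space_K) auto
      have "(1 - \<epsilon>) * D * max 0 (h - C * s) powr (\<beta> + 1)
          \<le> (1 - \<epsilon>) * c\<^sub>K s * max 0 (a + h - lower_edge K s) powr (\<beta> + 1)"
        using near[OF s] pos D \<epsilon> by (intro mult_mono powr_mono2) auto
      also have "\<dots> \<le> measure (K s) {ennreal a..ennreal (a + h)}"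
        using near[OF s] s h by (intro K_ge) auto
      finally show ?thesis
        using True by (simp add: g_def K.emeasure_eq_measure ennreal_leI)
    qed simp
    have fg: "ennreal ((1 - \<epsilon>) * (1 - \<epsilon>) * D * L) *
        (ennreal (s powr \<alpha> * max 0 (h - C * s) powr (\<beta> + 1)) * indicator {0<..} s)
        \<le> ennreal (f s) * g s * indicator J s" for s
    proof (cases "s \<in> J")
      case True
      then have s: "0 < s" "s < r" by (auto simp: J_def)
      have "ennreal ((1 - \<epsilon>) * (1 - \<epsilon>) * D * L) *
        ennreal (s powr \<alpha> * max 0 (h - C * s) powr (\<beta> + 1)) = ennreal ((1 - \<epsilon>) * (L * s powr \<alpha>)) * g s"
        unfolding g_def using \<epsilon> D pos by (simp add: ennreal_mult'[symmetric] mult_ac)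
      also have "\<dots> \<le> ennreal (f s) * g s"
        using near[OF s] by (intro mult_right_mono ennreal_leI) auto
      finally show ?thesis
        using True s by simp
    next
      case False
      \<comment> \<open>Here the restriction \<open>h < C * r\<close> enters: the whole support of
        the profile fits inside \<open>J\<close>.\<close>
      have "h - C * s \<le> 0" if "0 < s"
      proof -
        have "C * r \<le> C * s"
          using False that C by (intro mult_left_mono) (auto simp: J_def)
        then show ?thesis using h by simp
      qed
      then show ?thesis
        by (cases "0 < s") simp_all
    qed
    have "ennreal (\<kappa> * L * h powr (\<alpha> + \<beta> + 2))
        \<le> ennreal ((1 - \<epsilon>) * (1 - \<epsilon>) * (D * G C) * L * h powr (\<alpha> + \<beta> + 2))"
      using \<epsilon> pos by (intro ennreal_leI mult_right_mono) auto
    also have "\<dots> = ennreal ((1 - \<epsilon>) * (1 - \<epsilon>) * D * L) * ennreal (G C * h powr (\<alpha> + \<beta> + 2))"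
      using \<epsilon> D pos by (simp add: ennreal_mult'[symmetric] mult_ac)
    also have "\<dots> = (\<integral>\<^sup>+s. ennreal ((1 - \<epsilon>) * (1 - \<epsilon>) * D * L) *
        (ennreal (s powr \<alpha> * max 0 (h - C * s) powr (\<beta> + 1)) * indicator {0<..} s) \<partial>lborel)"
      using C h by (subst nn_integral_cmult) (auto simp: nn_integral_cone)
    also have "\<dots> \<le> (\<integral>\<^sup>+s\<in>J. ennreal (f s) * g s \<partial>lborel)"
      by (intro nn_integral_mono fg)
    also have "\<dots> = (\<integral>\<^sup>+s\<in>J. g s \<partial>F)"
      by (rule dens[OF g J, symmetric])
    also have "\<dots> \<le> (\<integral>\<^sup>+s. emeasure (K s) {ennreal a..ennreal (a + h)} \<partial>F)"
      by (intro nn_integral_mono K_ge_g)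
    also have "\<dots> = emeasure Q {ennreal a..ennreal (a + h)}"
      by (rule emeasure_Q[symmetric]) simp
    finally show ?thesis
      by (simp add: finite_measure.emeasure_eq_measure[OF prob_space.finite_measure[OF prob_space_Q]])
  qed
  show ?thesis
    using bound \<eta> C r by (intro eventually_at_rightI[of 0 "min \<eta> (C * r)"]) auto
qed

section \<open>Power law, support and logarithmic exponent\<close>

text \<open>One factor 1/2 makes \<open>c_low / 2\<close> an eventual lower bound of
  \<open>c\<^sub>K\<close>; the other provides the strict inequality required by
  \<open>Q_lower\<close>. The slope \<open>c\<^sub>p\<close> is the steepest edge that A5
  allows.\<close>

lemma Q_lower_Liminf:
  assumes "ereal c_low = Liminf (at_right 0) (\<lambda>s. ereal (c\<^sub>K s))"
  shows "0 < c_low"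
    and "\<forall>\<^sub>F h in at_right 0.
      c_low / 4 * G c\<^sub>p * L * h powr (\<alpha> + \<beta> + 2) \<le> measure Q {ennreal a..ennreal (a + h)}"
proof -
  show low: "0 < c_low"
    using A6 assms[symmetric] by (simp add: A6_def)
  have edge: "\<forall>\<^sub>F s in at_right 0. lower_edge K s - a \<le> c\<^sub>p * s"
    using pos edge_bounds by (intro eventually_at_rightI[of 0 s\<^sub>R]) auto
  have "\<forall>\<^sub>F s in at_right 0. ereal (c_low / 2) < ereal (c\<^sub>K s)"
    using low assms[symmetric] by (intro less_LiminfD) simp
  then have "\<forall>\<^sub>F s in at_right 0. c_low / 2 \<le> c\<^sub>K s"
    by (rule eventually_mono) auto
  then show "\<forall>\<^sub>F h in at_right 0.
      c_low / 4 * G c\<^sub>p * L * h powr (\<alpha> + \<beta> + 2) \<le> measure Q {ennreal a..ennreal (a + h)}"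
    using low pos G_pos[of c\<^sub>p] edge by (intro Q_lower[of c\<^sub>p "c_low / 2"]) auto
qed

text \<open>Dually, doubling \<open>c_up\<close> bounds \<open>c\<^sub>K\<close> eventually, and
  doubling again gives the strict gap for \<open>Q_upper\<close>. The slope \<open>c\<^sub>m\<close>
  is the flattest edge that A5 allows.\<close>

lemma Q_upper_Limsup:
  assumes "ereal c_up = Limsup (at_right 0) (\<lambda>s. ereal (c\<^sub>K s))"
  shows "0 < c_up"
    and "\<forall>\<^sub>F h in at_right 0.
      measure Q {ennreal a..ennreal (a + h)} \<le> 4 * c_up * G c\<^sub>m * L * h powr (\<alpha> + \<beta> + 2)"
proof -
  have "0 < Limsup (at_right 0) (\<lambda>s. ereal (c\<^sub>K s))"
    using A6 unfolding A6_def by (meson order.strict_trans2)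
  then show up: "0 < c_up"
    using assms[symmetric] by simp
  have edge: "\<forall>\<^sub>F s in at_right 0. c\<^sub>m * s \<le> lower_edge K s - a"
    using pos edge_bounds by (intro eventually_at_rightI[of 0 s\<^sub>R]) auto
  have "\<forall>\<^sub>F s in at_right 0. ereal (c\<^sub>K s) < ereal (2 * c_up)"
    using up assms[symmetric] by (intro Limsup_lessD) simp
  then have "\<forall>\<^sub>F s in at_right 0. c\<^sub>K s \<le> 2 * c_up"
    by (rule eventually_mono) auto
  then show "\<forall>\<^sub>F h in at_right 0.
      measure Q {ennreal a..ennreal (a + h)} \<le> 4 * c_up * G c\<^sub>m * L * h powr (\<alpha> + \<beta> + 2)"
    using up pos G_pos[of c\<^sub>m] edge by (intro Q_upper[of c\<^sub>m "2 * c_up"]) auto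
qed

text \<open>With \<open>L\<close> absorbed into the constants, this form suffices for the support
  and for the logarithmic limit.\<close>

lemma Q_power_bounds:
  obtains \<kappa>\<^sub>m \<kappa>\<^sub>p where "0 < \<kappa>\<^sub>m" "0 < \<kappa>\<^sub>p"
    and "\<forall>\<^sub>F h in at_right 0. \<kappa>\<^sub>m * h powr (\<alpha> + \<beta> + 2) \<le> measure Q {ennreal a..ennreal (a + h)}"
    and "\<forall>\<^sub>F h in at_right 0. measure Q {ennreal a..ennreal (a + h)} \<le> \<kappa>\<^sub>p * h powr (\<alpha> + \<beta> + 2)"
proof -
  have lims: "0 < Liminf (at_right 0) (\<lambda>s. ereal (c\<^sub>K s))"
      "Liminf (at_right 0) (\<lambda>s. ereal (c\<^sub>K s)) \<le> Limsup (at_right 0) (\<lambda>s. ereal (c\<^sub>K s))"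
      "Limsup (at_right 0) (\<lambda>s. ereal (c\<^sub>K s)) < \<infinity>"
    using A6 by (auto simp: A6_def)
  \<comment> \<open>Both limits are real, since A6 places them between a positive lower and a finite
    upper bound.\<close>
  obtain c_low where low: "ereal c_low = Liminf (at_right 0) (\<lambda>s. ereal (c\<^sub>K s))"
    using lims by (cases "Liminf (at_right 0) (\<lambda>s. ereal (c\<^sub>K s))") auto
  obtain c_up where up: "ereal c_up = Limsup (at_right 0) (\<lambda>s. ereal (c\<^sub>K s))"
    using lims by (cases "Limsup (at_right 0) (\<lambda>s. ereal (c\<^sub>K s))") auto
  show thesis
    using Q_lower_Liminf[OF low] Q_upper_Limsup[OF up] pos G_pos
    by (intro that[of "c_low / 4 * G c\<^sub>p * L" "4 * c_up * G c\<^sub>m * L"]) auto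
qed

text \<open>Kernels at \<open>s > 0\<close> put no mass below \<open>a\<close>, so a support point
  there would have a \<open>Q\<close>-null neighbourhood. Conversely, each neighbourhood of
  \<open>a\<close> contains some interval \<open>{ennreal a..ennreal (a + h)}\<close>, which has
  positive mass by the lower power bound.\<close>

lemma endpoint_eq_Inf_support: "ennreal a = Inf (measure_support Q)"
proof (rule antisym)
  show "ennreal a \<le> Inf (measure_support Q)"
  proof (rule Inf_greatest, rule ccontr)
    fix x assume x: "x \<in> measure_support Q" "\<not> ennreal a \<le> x"
    have "AE s in F. emeasure (K s) {..<ennreal a} = 0"
      using AE_pos
    proof eventually_elim
      case (elim s)
      have "emeasure (K s) {..<ennreal a} \<le> emeasure (K s) {..<ennreal (lower_edge K s)}"
        using elim endpoint_le[of s]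
        by (intro emeasure_mono) (auto simp: sets_K intro: order.strict_trans2 ennreal_leI)
      then show ?case
        using elim emeasure_K_below_edge[of s] by simp
    qed
    then have "emeasure Q {..<ennreal a} = 0"
      using emeasure_K_measurable[of "{..<ennreal a}"]
      by (simp add: emeasure_Q nn_integral_0_iff_AE)
    moreover have "0 < emeasure Q {..<ennreal a}"
      using x unfolding measure_support_def by (simp add: not_le)
    ultimately show False
      by simp
  qed
  have "ennreal a \<in> measure_support Q"
    unfolding measure_support_def
  proof safe
    fix U assume U: "open U" "ennreal a \<in> U"
    then obtain b where b: "ennreal a < b" "{ennreal a..<b} \<subseteq> U"
      using open_right[of U "ennreal a" top] by auto
    have "((\<lambda>h. ennreal (a + h)) \<longlongrightarrow> ennreal (a + 0)) (at_right 0)"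
      by (intro tendsto_intros)
    then have near: "\<forall>\<^sub>F h in at_right 0. ennreal (a + h) < b"
      using b(1) by (intro order_tendstoD(2)) auto
    obtain \<kappa> where \<kappa>: "0 < \<kappa>"
      "\<forall>\<^sub>F h in at_right 0. \<kappa> * h powr (\<alpha> + \<beta> + 2) \<le> measure Q {ennreal a..ennreal (a + h)}"
      using Q_power_bounds by metis
    have "\<forall>\<^sub>F h in at_right 0. ennreal (a + h) < b \<and> 0 < h \<and>
        \<kappa> * h powr (\<alpha> + \<beta> + 2) \<le> measure Q {ennreal a..ennreal (a + h)}"
      using near \<kappa>(2) by (intro eventually_conj eventually_at_right_less)
    then obtain h :: real where h: "ennreal (a + h) < b" "0 < h"
        "\<kappa> * h powr (\<alpha> + \<beta> + 2) \<le> measure Q {ennreal a..ennreal (a + h)}"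
      using eventually_happens trivial_limit_at_right_real by blast
    have "0 < \<kappa> * h powr (\<alpha> + \<beta> + 2)"
      using \<kappa>(1) h(2) by simp
    then have "0 < emeasure Q {ennreal a..ennreal (a + h)}"
      using h(3) by (simp add: finite_measure.emeasure_eq_measure[OF prob_space.finite_measure[OF prob_space_Q]])
    moreover have "{ennreal a..ennreal (a + h)} \<subseteq> {ennreal a..<b}"
      using h(1) by (auto intro: order.strict_trans1)
    then have "emeasure Q {ennreal a..ennreal (a + h)} \<le> emeasure Q U"
      using b(2) U(1) by (intro emeasure_mono) (auto simp: sets_Q)
    ultimately show "0 < emeasure Q U"
      by (rule order.strict_trans2)
  qed
  then show "Inf (measure_support Q) \<le> ennreal a"
    by (rule Inf_lower)
qed

text \<open>Taking logarithms in the power bounds leaves an error \<open>ln c / ln h\<close>, which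
  vanishes because \<open>ln h\<close> tends to minus infinity.\<close>

lemma log_ratio_tendsto:
  "((\<lambda>h. ln (measure Q {ennreal a..ennreal (a + h)}) / ln h) \<longlongrightarrow> \<alpha> + \<beta> + 2) (at_right 0)"
proof -
  let ?e = "\<alpha> + \<beta> + 2"
  let ?q = "\<lambda>h. measure Q {ennreal a..ennreal (a + h)}"
  obtain \<kappa>\<^sub>m \<kappa>\<^sub>p where \<kappa>: "0 < \<kappa>\<^sub>m" "0 < \<kappa>\<^sub>p"
    and low: "\<forall>\<^sub>F h in at_right 0. \<kappa>\<^sub>m * h powr ?e \<le> ?q h"
    and up: "\<forall>\<^sub>F h in at_right 0. ?q h \<le> \<kappa>\<^sub>p * h powr ?e"
    by (rule Q_power_bounds)
  have lim: "((\<lambda>h. ln c / ln h + ?e) \<longlongrightarrow> ?e) (at_right 0)" for c :: real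
  proof -
    have "((\<lambda>h. ln c / ln h) \<longlongrightarrow> 0) (at_right (0::real))"
      by (intro tendsto_divide_0[OF tendsto_const] filterlim_at_bot_imp_at_infinity ln_at_0)
    then show ?thesis
      using tendsto_add[OF _ tendsto_const[of ?e]] by fastforce
  qed
  have ln_power: "ln (c * h powr ?e) / ln h = ln c / ln h + ?e" if "0 < c" "0 < h" "h < 1" for c h :: real
    using that by (simp add: ln_mult ln_powr add_divide_distrib)
  \<comment> \<open>Division by the negative number \<open>ln h\<close> swaps the roles of
    \<open>\<kappa>\<^sub>p\<close> and \<open>\<kappa>\<^sub>m\<close>.\<close>
  have bounds: "\<forall>\<^sub>F h in at_right 0. ln \<kappa>\<^sub>p / ln h + ?e \<le> ln (?q h) / ln h \<and>
      ln (?q h) / ln h \<le> ln \<kappa>\<^sub>m / ln h + ?e"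
    using low up eventually_at_right_less eventually_at_right_less_bound[OF zero_less_one]
  proof eventually_elim
    case (elim h)
    then have pos: "0 < \<kappa>\<^sub>m * h powr ?e" "0 < \<kappa>\<^sub>p * h powr ?e"
      using \<kappa> by auto
    then have "0 < ?q h"
      using elim by linarith
    then have "ln (\<kappa>\<^sub>m * h powr ?e) \<le> ln (?q h)" "ln (?q h) \<le> ln (\<kappa>\<^sub>p * h powr ?e)"
      using pos elim by auto
    moreover have "ln h \<le> 0"
      using elim by simp
    ultimately show ?case
      using \<kappa> elim by (simp add: ln_power[symmetric] divide_right_mono_neg)
  qed
  show ?thesis
    by (rule tendsto_sandwich[OF _ _ lim[of \<kappa>\<^sub>p] lim[of \<kappa>\<^sub>m]])
      (use bounds in \<open>auto elim: eventually_mono\<close>)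
qed

section \<open>Sharp constant for a linear edge\<close>

text \<open>With an exactly linear edge, \<open>Q_upper\<close> and \<open>Q_lower\<close> apply
  with the same slope, and \<open>D\<close> may be taken arbitrarily close to \<open>cbar\<close> on
  either side. The bounds then squeeze the normalised mass to
  \<open>cbar * G c\<^sub>l\<close>.\<close>

lemma linear_edge_asymp:
  assumes edge: "\<forall>s\<in>{0..s\<^sub>R}. edge K s = a + c\<^sub>l * s"
    and cbar: "0 < cbar" "(c\<^sub>K \<longlongrightarrow> cbar) (at_right 0)"
  shows "(\<lambda>h. measure Q {ennreal a..ennreal (a + h)}) \<sim>[at_right 0]
    (\<lambda>h. cbar * Beta (\<alpha> + 1) (\<beta> + 2) * L * c\<^sub>l powr (- (\<alpha> + 1)) * h powr (\<alpha> + \<beta> + 2))"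
proof -
  have linear: "lower_edge K s - a = c\<^sub>l * s" if "0 < s" "s \<le> s\<^sub>R" for s
    using bspec[OF edge, of s] that by (simp add: edge_def)
  \<comment> \<open>Comparison with A5 at the single point \<open>s\<^sub>R\<close> shows that the
    slope is positive.\<close>
  have "c\<^sub>m * s\<^sub>R \<le> c\<^sub>l * s\<^sub>R"
    using edge_bounds[of s\<^sub>R] linear[of s\<^sub>R] pos by simp
  then have cl: "0 < c\<^sub>l"
    using pos by simp
  have "\<forall>\<^sub>F s in at_right 0. lower_edge K s - a = c\<^sub>l * s"
    using linear pos by (intro eventually_at_rightI[of 0 s\<^sub>R]) auto
  then have edge_le: "\<forall>\<^sub>F s in at_right 0. lower_edge K s - a \<le> c\<^sub>l * s"
    and edge_ge: "\<forall>\<^sub>F s in at_right 0. c\<^sub>l * s \<le> lower_edge K s - a"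
    by (auto elim: eventually_mono)
  note G = G_pos[OF cl]
  let ?g = "\<lambda>h. L * h powr (\<alpha> + \<beta> + 2)"
  let ?q = "\<lambda>h. measure Q {ennreal a..ennreal (a + h)}"
  have g_pos: "\<forall>\<^sub>F h in at_right 0. 0 < ?g h"
    using pos by (auto intro!: eventually_at_rightI[of 0 1])
  have "((\<lambda>h. ?q h / ?g h) \<longlongrightarrow> cbar * G c\<^sub>l) (at_right 0)"
  proof (rule order_tendstoI)
    fix x assume "x < cbar * G c\<^sub>l"
    \<comment> \<open>The maximum with 0 ensures \<open>D > 0\<close> even for negative
      \<open>x\<close>.\<close>
    then have "max 0 (x / G c\<^sub>l) < cbar"
      using G cbar by (simp add: pos_divide_less_eq)
    then obtain D where D: "max 0 (x / G c\<^sub>l) < D" "D < cbar"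
      using dense by blast
    then have "x < D * G c\<^sub>l"
      using G by (simp add: pos_divide_less_eq)
    then obtain \<kappa> where \<kappa>: "x < \<kappa>" "\<kappa> < D * G c\<^sub>l"
      using dense by blast
    have "\<forall>\<^sub>F s in at_right 0. D \<le> c\<^sub>K s"
      using order_tendstoD(1)[OF cbar(2) D(2)] by (rule eventually_mono) simp
    then have "\<forall>\<^sub>F h in at_right 0. \<kappa> * L * h powr (\<alpha> + \<beta> + 2) \<le> ?q h"
      using D(1) \<kappa>(2) cl edge_le by (intro Q_lower) auto
    then show "\<forall>\<^sub>F h in at_right 0. x < ?q h / ?g h"
      using g_pos
    proof eventually_elim
      case (elim h)
      have "x * ?g h < \<kappa> * ?g h"
        using \<kappa>(1) elim(2) by (rule mult_strict_right_mono)
      then show ?case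
        using elim by (simp add: pos_less_divide_eq mult.assoc)
    qed
  next
    fix x assume "cbar * G c\<^sub>l < x"
    then have "cbar < x / G c\<^sub>l"
      using G by (simp add: pos_less_divide_eq)
    then obtain D where D: "cbar < D" "D < x / G c\<^sub>l"
      using dense by blast
    then have "D * G c\<^sub>l < x"
      using G by (simp add: pos_less_divide_eq)
    then obtain \<kappa> where \<kappa>: "D * G c\<^sub>l < \<kappa>" "\<kappa> < x"
      using dense by blast
    have "\<forall>\<^sub>F s in at_right 0. c\<^sub>K s \<le> D"
      using order_tendstoD(2)[OF cbar(2) D(1)] by (rule eventually_mono) simp
    then have "\<forall>\<^sub>F h in at_right 0. ?q h \<le> \<kappa> * L * h powr (\<alpha> + \<beta> + 2)"
      using D(1) cbar(1) \<kappa>(1) cl edge_ge by (intro Q_upper) auto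
    then show "\<forall>\<^sub>F h in at_right 0. ?q h / ?g h < x"
      using g_pos
    proof eventually_elim
      case (elim h)
      have "\<kappa> * ?g h < x * ?g h"
        using \<kappa>(2) elim(2) by (rule mult_strict_right_mono)
      then show ?case
        using elim by (simp add: pos_divide_less_eq mult.assoc)
    qed
  qed
  then have "?q \<sim>[at_right 0] (\<lambda>h. cbar * G c\<^sub>l * ?g h)"
    by (rule asymp_equivI'_const) (use G cbar in auto)
  then show ?thesis
    by (simp add: G_def mult_ac)
qed

end

section \<open>Identification of the exponent and assembly\<close>

text \<open>Equal observed laws have equal support infima, hence equal endpoints, as
  \<open>ennreal\<close> is injective on nonnegative reals. The logarithmic limits then concern the
  same function and coincide.\<close>

lemma exponent_unique:
  assumes "lean_member \<beta> c\<^sub>m c\<^sub>p sbar s\<^sub>R \<alpha> L F K c\<^sub>K"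
    and "lean_member \<beta>' c\<^sub>m' c\<^sub>p' sbar' s\<^sub>R' \<alpha>' L' F' K' c\<^sub>K'"
    and "observed_law F K = observed_law F' K'"
  shows "\<alpha> + \<beta> = \<alpha>' + \<beta>'"
proof -
  interpret m: lean_member \<beta> c\<^sub>m c\<^sub>p sbar s\<^sub>R \<alpha> L F K c\<^sub>K by fact
  interpret m': lean_member \<beta>' c\<^sub>m' c\<^sub>p' sbar' s\<^sub>R' \<alpha>' L' F' K' c\<^sub>K' by fact
  have "ennreal m.a = ennreal m'.a"
    using m.endpoint_eq_Inf_support m'.endpoint_eq_Inf_support assms(3) by simp
  then have "m.a = m'.a"
    using m.endpoint_nonneg m'.endpoint_nonneg by simp
  then have "\<alpha> + \<beta> + 2 = \<alpha>' + \<beta>' + 2"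
    using tendsto_unique[OF _ m.log_ratio_tendsto] m'.log_ratio_tendsto assms(3)
    by (simp add: trivial_limit_at_right_real)
  then show ?thesis by simp
qed

text \<open>The order of quantifiers expresses the permitted dependence: both constants are chosen
  before \<open>L\<close>, the scales and the member. That \<open>Q\<close> alone determines the
  exponent is rendered as agreement of any two representations of \<open>Q\<close>, even with
  different class constants.\<close>

theorem lemma4p1:
  fixes \<beta> c\<^sub>m c\<^sub>p \<alpha> c_low c_up :: real
  shows "\<exists>\<kappa>\<^sub>m \<kappa>\<^sub>p. 0 < \<kappa>\<^sub>m \<and> \<kappa>\<^sub>m \<le> \<kappa>\<^sub>p \<and>
    (\<forall>sbar s\<^sub>R F K L c\<^sub>K a Q.
       class_constants \<beta> c\<^sub>m c\<^sub>p sbar s\<^sub>R \<and>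
       (F, K) \<in> lean_class \<beta> c\<^sub>m c\<^sub>p sbar s\<^sub>R \<and>
       A1 sbar F \<alpha> L \<and> A6 \<beta> s\<^sub>R K c\<^sub>K \<and>
       ereal c_low = Liminf (at_right 0) (\<lambda>s. ereal (c\<^sub>K s)) \<and>
       ereal c_up = Limsup (at_right 0) (\<lambda>s. ereal (c\<^sub>K s)) \<and>
       a = apparent_endpoint K \<and> Q = observed_law F K
       \<longrightarrow>
       (\<forall>\<^sub>F h in at_right 0.
          \<kappa>\<^sub>m * L * h powr (\<alpha> + \<beta> + 2) \<le> measure Q {ennreal a..ennreal (a + h)} \<and>
          measure Q {ennreal a..ennreal (a + h)} \<le> \<kappa>\<^sub>p * L * h powr (\<alpha> + \<beta> + 2)) \<and>
       ennreal a = Inf (measure_support Q) \<and>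
       ((\<lambda>h. ln (measure Q {ennreal a..ennreal (a + h)}) / ln h) \<longlongrightarrow> \<alpha> + \<beta> + 2) (at_right 0) \<and>
       (\<forall>\<beta>' c\<^sub>m' c\<^sub>p' sbar' s\<^sub>R' F' K' \<alpha>' L'.
          class_constants \<beta>' c\<^sub>m' c\<^sub>p' sbar' s\<^sub>R' \<and>
          (F', K') \<in> lean_class \<beta>' c\<^sub>m' c\<^sub>p' sbar' s\<^sub>R' \<and>
          A1 sbar' F' \<alpha>' L' \<and> observed_law F' K' = Q
          \<longrightarrow> \<alpha>' + \<beta>' + 2 = \<alpha> + \<beta> + 2) \<and>
       (\<forall>c\<^sub>l cbar.
          (\<forall>s\<in>{0..s\<^sub>R}. edge K s = a + c\<^sub>l * s) \<and> 0 < cbar \<and> (c\<^sub>K \<longlongrightarrow> cbar) (at_right 0)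
          \<longrightarrow> (\<lambda>h. measure Q {ennreal a..ennreal (a + h)}) \<sim>[at_right 0]
              (\<lambda>h. cbar * Beta (\<alpha> + 1) (\<beta> + 2) * L * c\<^sub>l powr (- (\<alpha> + 1)) * h powr (\<alpha> + \<beta> + 2))))"
proof -
  \<comment> \<open>These are the constants of \<open>Q_lower_Liminf\<close> and
    \<open>Q_upper_Limsup\<close> with \<open>G\<close> written out, since no member is fixed
    yet.\<close>
  define \<kappa>\<^sub>0 where "\<kappa>\<^sub>0 = c_low / 4 * (Beta (\<alpha> + 1) (\<beta> + 2) * c\<^sub>p powr (- (\<alpha> + 1)))"
  \<comment> \<open>The conditional and the maximum only matter for parameters that admit no member.\<close>
  define \<kappa>\<^sub>m where "\<kappa>\<^sub>m = (if 0 < \<kappa>\<^sub>0 then \<kappa>\<^sub>0 else 1)"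
  define \<kappa>\<^sub>p where "\<kappa>\<^sub>p = max \<kappa>\<^sub>m (4 * c_up * (Beta (\<alpha> + 1) (\<beta> + 2) * c\<^sub>m powr (- (\<alpha> + 1))))"
  show ?thesis
  proof (rule exI[of _ \<kappa>\<^sub>m], rule exI[of _ \<kappa>\<^sub>p], intro conjI allI impI; (elim conjE)?)
    show "0 < \<kappa>\<^sub>m" "\<kappa>\<^sub>m \<le> \<kappa>\<^sub>p"
      by (simp_all add: \<kappa>\<^sub>m_def \<kappa>\<^sub>p_def)
  next
    fix sbar s\<^sub>R F K L c\<^sub>K a Q
    assume "class_constants \<beta> c\<^sub>m c\<^sub>p sbar s\<^sub>R" "(F, K) \<in> lean_class \<beta> c\<^sub>m c\<^sub>p sbar s\<^sub>R"
      "A1 sbar F \<alpha> L" "A6 \<beta> s\<^sub>R K c\<^sub>K"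
    then interpret lean_member \<beta> c\<^sub>m c\<^sub>p sbar s\<^sub>R \<alpha> L F K c\<^sub>K
      by unfold_locales
    assume low: "ereal c_low = Liminf (at_right 0) (\<lambda>s. ereal (c\<^sub>K s))"
      and up: "ereal c_up = Limsup (at_right 0) (\<lambda>s. ereal (c\<^sub>K s))"
      and a: "a = apparent_endpoint K" and Q: "Q = observed_law F K"
    \<comment> \<open>A member forces \<open>c_low\<close> and \<open>G c\<^sub>p\<close> to be
      positive, so the conditional takes its first branch.\<close>
    have \<kappa>\<^sub>m: "\<kappa>\<^sub>m = c_low / 4 * G c\<^sub>p"
      using Q_lower_Liminf(1)[OF low] G_pos[of c\<^sub>p] pos by (simp add: \<kappa>\<^sub>m_def \<kappa>\<^sub>0_def G_def)
    have \<kappa>\<^sub>p: "4 * c_up * G c\<^sub>m \<le> \<kappa>\<^sub>p"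
      by (simp add: \<kappa>\<^sub>p_def G_def)
    show "\<forall>\<^sub>F h in at_right 0.
        \<kappa>\<^sub>m * L * h powr (\<alpha> + \<beta> + 2) \<le> measure Q {ennreal a..ennreal (a + h)} \<and>
        measure Q {ennreal a..ennreal (a + h)} \<le> \<kappa>\<^sub>p * L * h powr (\<alpha> + \<beta> + 2)"
      using Q_lower_Liminf(2)[OF low] Q_upper_Limsup(2)[OF up] unfolding a Q \<kappa>\<^sub>m
    proof eventually_elim
      case (elim h)
      have "4 * c_up * G c\<^sub>m * L * h powr (\<alpha> + \<beta> + 2) \<le> \<kappa>\<^sub>p * L * h powr (\<alpha> + \<beta> + 2)"
        using \<kappa>\<^sub>p pos by (intro mult_right_mono) auto
      then show ?case
        using elim by linarith
    qed
    show "ennreal a = Inf (measure_support Q)"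
      unfolding a Q by (rule endpoint_eq_Inf_support)
    show "((\<lambda>h. ln (measure Q {ennreal a..ennreal (a + h)}) / ln h) \<longlongrightarrow> \<alpha> + \<beta> + 2) (at_right 0)"
      unfolding a Q by (rule log_ratio_tendsto)
    show "\<alpha>' + \<beta>' + 2 = \<alpha> + \<beta> + 2"
      if member': "class_constants \<beta>' c\<^sub>m' c\<^sub>p' sbar' s\<^sub>R'" "(F', K') \<in> lean_class \<beta>' c\<^sub>m' c\<^sub>p' sbar' s\<^sub>R'"
        "A1 sbar' F' \<alpha>' L'" "observed_law F' K' = Q" for \<beta>' c\<^sub>m' c\<^sub>p' sbar' s\<^sub>R' F' K' \<alpha>' L'
    proof -
      obtain c\<^sub>K' where "A6 \<beta>' s\<^sub>R' K' c\<^sub>K'"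
        using member'(2) by (auto simp: lean_class_def)
      then have "lean_member \<beta>' c\<^sub>m' c\<^sub>p' sbar' s\<^sub>R' \<alpha>' L' F' K' c\<^sub>K'"
        using member' by unfold_locales
      then show ?thesis
        using exponent_unique[OF _ lean_member_axioms] member'(4) Q by simp
    qed
    show "(\<lambda>h. measure Q {ennreal a..ennreal (a + h)}) \<sim>[at_right 0]
        (\<lambda>h. cbar * Beta (\<alpha> + 1) (\<beta> + 2) * L * c\<^sub>l powr (- (\<alpha> + 1)) * h powr (\<alpha> + \<beta> + 2))"
      if "\<forall>s\<in>{0..s\<^sub>R}. edge K s = a + c\<^sub>l * s" "0 < cbar" "(c\<^sub>K \<longlongrightarrow> cbar) (at_right 0)" for c\<^sub>l cbar
      using that linear_edge_asymp unfolding a Q by blast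
  qed
qed

end
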